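(* Let $d\ge1$, $\sigma>0$, $\Omega\in C(\mathbf{R};\mathbf{R})$, and let $H$ be a real-valued function of time. Let $v$ solve, on an open time interval $I$ containing $0$, $$i\partial_tv+\tfrac12\Delta v=H(t)|v|^{2\sigma}v,\qquad v_{\mid t=0}=u_0.$$ Let $(\mu,\nu)$ be given by $\ddot\mu+\Omega(t)\mu=0$, $\mu(0)=0$, $\dot\mu(0)=1$, and $\ddot\nu+\Omega(t)\nu=0$, $\nu(0)=1$, $\dot\nu(0)=0$. There exists $T>0$ (such that $\nu>0$ on $[-T,T]$ and $\mu(t)/\nu(t)\in I$ for $|t|\le T$) for which the following holds. Define $$u(t,x)=\frac{1}{\nu(t)^{d/2}}\,v\left(\frac{\mu(t)}{\nu(t)},\frac{x}{\nu(t)}\right)e^{i\frac{\dot\nu(t)}{\nu(t)}\frac{|x|^2}{2}},\qquad |t|\le T.$$ Then for $|t|<T$, $u$ solves $$i\partial_tu+\tfrac12\Delta u=\tfrac12\Omega(t)|x|^2u+h(t)|u|^{2\sigma}u,\qquad u_{\mid t=0}=u_0,$$ where $h(t)=\nu(t)^{d\sigma-2}H\left(\mu(t)/\nu(t)\right)$.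
   Context: $u$ and $v$ are complex-valued functions on time interval $\times\,\mathbf{R}^d$. *)

theory Defs
  imports "HOL-Analysis.Analysis"
begin

text \<open>Functions on time \<times> space are curried: \<open>w t x\<close> with \<open>t :: real\<close> and \<open>x :: real ^ 'd\<close>.\<close>

definition time_deriv :: "(real \<Rightarrow> real ^ 'd \<Rightarrow> complex) \<Rightarrow> real \<Rightarrow> real ^ 'd \<Rightarrow> complex" where
  "time_deriv w t x = vector_derivative (\<lambda>s. w s x) (at t)"

definition space_differentiable :: "'d \<Rightarrow> (real ^ 'd \<Rightarrow> complex) \<Rightarrow> real ^ 'd \<Rightarrow> bool" where
  "space_differentiable j f x \<longleftrightarrow> (\<lambda>s::real. f (x + s *\<^sub>R axis j 1)) differentiable (at 0)"

definition space_deriv :: "'d \<Rightarrow> (real ^ 'd \<Rightarrow> complex) \<Rightarrow> real ^ 'd \<Rightarrow> complex" where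
  "space_deriv j f x = vector_derivative (\<lambda>s::real. f (x + s *\<^sub>R axis j 1)) (at 0)"

definition laplacian :: "(real ^ 'd \<Rightarrow> complex) \<Rightarrow> real ^ 'd \<Rightarrow> complex" where
  "laplacian f x = (\<Sum>j\<in>UNIV. space_deriv j (space_deriv j f) x)"

text \<open>The class \<open>C\<^sup>1\<close> in time and \<open>C\<^sup>2\<close> in space: all the partial derivatives involved exist and are
  jointly continuous. The library operator \<^const>\<open>vector_derivative\<close> is total, so existence is
  required separately.\<close>

definition C12_on :: "real set \<Rightarrow> (real \<Rightarrow> real ^ 'd \<Rightarrow> complex) \<Rightarrow> bool" where
  "C12_on J w \<longleftrightarrow>
     (\<forall>t\<in>J. \<forall>x. (\<lambda>s. w s x) differentiable (at t)) \<and>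
     (\<forall>t\<in>J. \<forall>x j. space_differentiable j (w t) x) \<and>
     (\<forall>t\<in>J. \<forall>x j k. space_differentiable k (space_deriv j (w t)) x) \<and>
     continuous_on (J \<times> UNIV) (\<lambda>(t, x). w t x) \<and>
     continuous_on (J \<times> UNIV) (\<lambda>(t, x). time_deriv w t x) \<and>
     (\<forall>j. continuous_on (J \<times> UNIV) (\<lambda>(t, x). space_deriv j (w t) x)) \<and>
     (\<forall>j k. continuous_on (J \<times> UNIV) (\<lambda>(t, x). space_deriv k (space_deriv j (w t)) x))"

text \<open>Classical solutions on the open time interval \<open>J\<close> (containing 0) of
  \<open>i \<partial>\<^sub>t w + 1/2 \<Delta> w = F(t, x, w)\<close> with \<open>w = u0\<close> at time 0.\<close>

definition schroedinger_solution ::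
  "real set \<Rightarrow> (real \<Rightarrow> real ^ 'd \<Rightarrow> complex \<Rightarrow> complex) \<Rightarrow> (real ^ 'd \<Rightarrow> complex) \<Rightarrow>
   (real \<Rightarrow> real ^ 'd \<Rightarrow> complex) \<Rightarrow> bool" where
  "schroedinger_solution J F u0 w \<longleftrightarrow>
     C12_on J w \<and>
     (\<forall>t\<in>J. \<forall>x. \<i> * time_deriv w t x + (1 / 2) * laplacian (w t) x = F t x (w t x)) \<and>
     (\<forall>x. w 0 x = u0 x)"

text \<open>The linear problem \<open>y'' + \<Omega>(t) y = 0\<close> on the whole line, with \<open>y(0) = a\<close> and \<open>y'(0) = b\<close>.\<close>

definition oscillator_solution ::
  "(real \<Rightarrow> real) \<Rightarrow> real \<Rightarrow> real \<Rightarrow> (real \<Rightarrow> real) \<Rightarrow> bool" where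
  "oscillator_solution \<Omega> a b y \<longleftrightarrow>
     (\<forall>t. y differentiable (at t)) \<and>
     (\<forall>t. deriv y differentiable (at t)) \<and>
     (\<forall>t. deriv (deriv y) t + \<Omega> t * y t = 0) \<and>
     y 0 = a \<and> deriv y 0 = b"

end

theory Submission
  imports Defs
begin

text \<open>The space derivatives of \<open>u\<close> come from the product rule. Its time derivative needs the Frechet
  differentiability of \<open>v\<close> in \<open>(t, x)\<close>, which follows from the continuity of the partial derivatives.
  With \<open>b = \<nu>'/\<nu>\<close>, the phase factor turns \<open>\<Delta>/2\<close> into \<open>\<Delta>/2\<close> plus a transport term, the term
  \<open>i d b/2\<close> and the potential \<open>- b\<^sup>2 |x|\<^sup>2/2\<close>. The time derivatives of the dilation and of
  \<open>\<nu> powr (- d/2)\<close> cancel the first two, and that of the phase contributes \<open>- b' |x|\<^sup>2/2\<close>, where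
  \<open>b' + b\<^sup>2 = \<nu>''/\<nu> = - \<Omega>\<close>. The Wronskian \<open>\<mu>' \<nu> - \<mu> \<nu>' = 1\<close> gives the derivative
  \<open>1/\<nu>\<^sup>2\<close> of \<open>\<mu>/\<nu>\<close>, which is the scaling factor of \<open>\<Delta>\<close> under the dilation.\<close>

section \<open>Frechet differentiability from continuous partial derivatives\<close>

text \<open>The path from \<open>x\<close> to a nearby point is split into segments parallel to the
  basis vectors, so the partial derivatives are needed on a neighbourhood of \<open>x\<close> and
  not only at \<open>x\<close>. With an abstract \<open>Basis\<close>, the criterion covers the
  product of time and space, time being one more coordinate.\<close>

lemma has_derivative_if_continuous_partials:
  fixes g :: "'a::euclidean_space \<Rightarrow> 'b::real_normed_vector"
  assumes "open S" "x \<in> S"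
    and D: "\<And>y b. y \<in> S \<Longrightarrow> b \<in> Basis \<Longrightarrow> ((\<lambda>s. g (y + s *\<^sub>R b)) has_vector_derivative D b y) (at 0)"
    and cont: "\<And>b. b \<in> Basis \<Longrightarrow> continuous_on S (D b)"
  shows "(g has_derivative (\<lambda>h. \<Sum>b\<in>Basis. (h \<bullet> b) *\<^sub>R D b x)) (at x)"
  unfolding has_derivative_at_alt
proof (intro conjI allI impI)
  show "bounded_linear (\<lambda>h. \<Sum>b\<in>Basis. (h \<bullet> b) *\<^sub>R D b x)"
    by (intro bounded_linear_sum bounded_linear_scaleR_left[THEN bounded_linear_compose]
        bounded_linear_inner_left)
  fix e :: real assume "e > 0"
  \<comment> \<open>Each of the \<open>DIM('a)\<close> segments will contribute at most
    \<open>c * norm h\<close> to the error.\<close>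
  define c where "c = e / DIM('a)"
  have "c > 0" using \<open>e > 0\<close> by (simp add: c_def)
  have "eventually (\<lambda>y. \<forall>b\<in>Basis. dist (D b y) (D b x) < c) (nhds x)"
  proof (intro eventually_ball_finite ballI finite_Basis)
    fix b :: 'a assume "b \<in> Basis"
    then have "isCont (D b) x"
      using cont continuous_on_eq_continuous_at[OF \<open>open S\<close>] \<open>x \<in> S\<close> by blast
    then have "(D b \<longlongrightarrow> D b x) (nhds x)"
      by (simp add: continuous_at tendsto_at_iff_tendsto_nhds)
    then show "eventually (\<lambda>y. dist (D b y) (D b x) < c) (nhds x)"
      using \<open>c > 0\<close> by (rule tendstoD)
  qed
  moreover have "eventually (\<lambda>y. y \<in> S) (nhds x)"
    using assms(1,2) by (simp add: eventually_nhds_in_open)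
  ultimately have "eventually (\<lambda>y. y \<in> S \<and> (\<forall>b\<in>Basis. dist (D b y) (D b x) < c)) (nhds x)"
    by eventually_elim auto
  then obtain d where "d > 0"
    and d: "\<And>y. dist y x < d \<Longrightarrow> y \<in> S \<and> (\<forall>b\<in>Basis. dist (D b y) (D b x) < c)"
    unfolding eventually_nhds_metric by blast
  have "norm (g y - g x - (\<Sum>b\<in>Basis. ((y - x) \<bullet> b) *\<^sub>R D b x)) \<le> e * norm (y - x)"
    if "norm (y - x) < d" for y
  proof -
    define h where "h = y - x"
    define p where "p A = (\<Sum>b\<in>A. (h \<bullet> b) *\<^sub>R b)" for A
    \<comment> \<open>The coordinates of any intermediate point are bounded by those of
      \<open>h\<close>, so the whole path stays in the ball on which the partial derivatives are
      controlled.\<close>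
    have small: "norm (p A + s *\<^sub>R b) < d"
      if "A \<subseteq> Basis" "b \<in> Basis" "b \<notin> A" "\<bar>s\<bar> \<le> \<bar>h \<bullet> b\<bar>" for A b s
    proof -
      have fin: "finite A" using that(1) finite_Basis finite_subset by blast
      have "norm (p A + s *\<^sub>R b) \<le> norm h"
      proof (rule norm_le_componentwise)
        fix c :: 'a assume c: "c \<in> Basis"
        have "p A \<bullet> c = (\<Sum>b\<in>A. if b = c then h \<bullet> c else 0)"
          using that(1) c by (auto simp: p_def inner_sum_left inner_Basis intro!: sum.cong)
        also have "\<dots> = (if c \<in> A then h \<bullet> c else 0)"
          using fin by simp
        finally show "\<bar>(p A + s *\<^sub>R b) \<bullet> c\<bar> \<le> \<bar>h \<bullet> c\<bar>"
          using that c by (auto simp: inner_add_left inner_Basis)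
      qed
      then show ?thesis using \<open>norm (y - x) < d\<close> by (simp add: h_def)
    qed
    \<comment> \<open>The increment telescopes along the coordinate directions; each new direction costs one
        application of the mean value inequality to \<open>G\<close>.\<close>
    have "norm (g (x + p A) - g x - (\<Sum>b\<in>A. (h \<bullet> b) *\<^sub>R D b x)) \<le> card A * (c * norm h)"
      if "A \<subseteq> Basis" for A
      using finite_subset[OF that finite_Basis] that
    proof (induction A rule: finite_induct)
      case empty
      then show ?case by (simp add: p_def)
    next
      case (insert b A)
      \<comment> \<open>Subtracting the linear term makes the derivative of \<open>G\<close> the
        oscillation of \<open>D b\<close>, which is below \<open>c\<close>, and makes
        \<open>G (h \<bullet> b) - G 0\<close> the new error. The interval \<open>?J\<close> is
        symmetric because \<open>h \<bullet> b\<close> may have either sign.\<close>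
      define G where "G s = g (x + p A + s *\<^sub>R b) - s *\<^sub>R D b x" for s
      let ?J = "{s. \<bar>s\<bar> \<le> \<bar>h \<bullet> b\<bar>}"
      have J: "?J = {- \<bar>h \<bullet> b\<bar>..\<bar>h \<bullet> b\<bar>}" by (auto simp: abs_le_iff)
      have inS: "x + p A + s *\<^sub>R b \<in> S \<and> dist (D b (x + p A + s *\<^sub>R b)) (D b x) < c"
        if "s \<in> ?J" for s
        using d[of "x + p A + s *\<^sub>R b"] small[of A b s] insert that
        by (auto simp: dist_norm algebra_simps)
      have der: "(G has_vector_derivative (D b (x + p A + s *\<^sub>R b) - D b x)) (at s)"
        if "s \<in> ?J" for s
      proof -
        \<comment> \<open>The point 0 is written as \<open>s - s\<close> to fit the chain rule for
          the translation \<open>r - s\<close>, which moves the derivative from 0 to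
          \<open>s\<close>.\<close>
        have "((\<lambda>r. g (x + p A + s *\<^sub>R b + r *\<^sub>R b)) has_vector_derivative D b (x + p A + s *\<^sub>R b))
                (at (s - s))"
          using D[of "x + p A + s *\<^sub>R b" b] inS[OF that] insert by simp
        then have "((\<lambda>r. g (x + p A + s *\<^sub>R b + (r - s) *\<^sub>R b))
                has_vector_derivative 1 *\<^sub>R D b (x + p A + s *\<^sub>R b)) (at s)"
          by (intro vector_diff_chain_at[where f="\<lambda>r. r - s", unfolded o_def])
             (auto intro!: derivative_eq_intros)
        then have "((\<lambda>r. g (x + p A + r *\<^sub>R b)) has_vector_derivative D b (x + p A + s *\<^sub>R b)) (at s)"
          by (simp add: algebra_simps)
        then show ?thesis
          unfolding G_def by (auto intro!: derivative_eq_intros)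
      qed
      have "norm (G (h \<bullet> b) - G 0) \<le> c * norm (h \<bullet> b - 0)"
      proof (rule differentiable_bound)
        show "convex ?J" by (simp add: J)
        show "(G has_derivative (\<lambda>r. r *\<^sub>R (D b (x + p A + s *\<^sub>R b) - D b x))) (at s within ?J)"
          if "s \<in> ?J" for s
          using der[OF that] by (simp add: has_vector_derivative_def has_derivative_at_withinI)
        show "onorm (\<lambda>r. r *\<^sub>R (D b (x + p A + s *\<^sub>R b) - D b x)) \<le> c" if "s \<in> ?J" for s
          using inS[OF that] \<open>c > 0\<close>
          by (intro onorm_bound) (auto simp: dist_norm mult.commute[of c] intro!: mult_left_mono)
      qed auto
      also have "\<dots> \<le> c * norm h"
        using \<open>c > 0\<close> insert by (auto intro!: mult_left_mono Basis_le_norm)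
      finally have "norm (g (x + p (insert b A)) - g (x + p A) - (h \<bullet> b) *\<^sub>R D b x) \<le> c * norm h"
        using insert by (simp add: G_def p_def algebra_simps)
      moreover have "norm (g (x + p A) - g x - (\<Sum>b\<in>A. (h \<bullet> b) *\<^sub>R D b x)) \<le> card A * (c * norm h)"
        using insert by simp
      ultimately have "norm ((g (x + p (insert b A)) - g (x + p A) - (h \<bullet> b) *\<^sub>R D b x) +
           (g (x + p A) - g x - (\<Sum>b\<in>A. (h \<bullet> b) *\<^sub>R D b x))) \<le> c * norm h + card A * (c * norm h)"
        by (rule norm_triangle_mono)
      then show ?case using insert by (simp add: algebra_simps)
    qed
    from this[of Basis] show ?thesis
      by (simp add: p_def euclidean_representation c_def h_def)
  qed
  then show "\<exists>d>0. \<forall>y. norm (y - x) < d \<longrightarrow>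
      norm (g y - g x - (\<Sum>b\<in>Basis. ((y - x) \<bullet> b) *\<^sub>R D b x)) \<le> e * norm (y - x)"
    using \<open>d > 0\<close> by blast
qed

section \<open>Coordinate derivatives in space and joint differentiability in time and space\<close>

lemma Basis_vec_real: "(Basis :: (real ^ 'd) set) = range (\<lambda>j. axis j 1)"
  by (auto simp: Basis_vec_def)

lemma space_deriv_eqI:
  "((\<lambda>s. f (x + s *\<^sub>R axis j 1)) has_vector_derivative D) (at 0) \<Longrightarrow> space_deriv j f x = D"
  unfolding space_deriv_def by (rule vector_derivative_at)

lemma space_differentiableI:
  "((\<lambda>s. f (x + s *\<^sub>R axis j 1)) has_vector_derivative D) (at 0) \<Longrightarrow> space_differentiable j f x"
  unfolding space_differentiable_def by (rule differentiableI_vector)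

lemma has_space_deriv:
  "space_differentiable j f x \<Longrightarrow>
    ((\<lambda>s. f (x + s *\<^sub>R axis j 1)) has_vector_derivative space_deriv j f x) (at 0)"
  unfolding space_deriv_def space_differentiable_def by (simp add: vector_derivative_works)

text \<open>Serves to differentiate \<open>v\<close> along a curve on which time and position move
  together, as they do under the lens change of variables.\<close>

lemma C12_on_has_derivative:
  fixes v :: "real \<Rightarrow> real ^ 'd \<Rightarrow> complex"
  assumes "C12_on I v" "open I" "t \<in> I"
  shows "((\<lambda>(t, x). v t x) has_derivative
      (\<lambda>(r, y). r *\<^sub>R time_deriv v t x + (\<Sum>j\<in>UNIV. (y $ j) *\<^sub>R space_deriv j (v t) x))) (at (t, x))"
proof -
  let ?g = "\<lambda>(t, x). v t x"
  \<comment> \<open>Taking \<open>D\<close> linear in the direction avoids a case distinction on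
    basis vectors; at these it reduces to the time derivative and the space derivatives.\<close>
  define D where "D = (\<lambda>(r, e) (t, x). r *\<^sub>R time_deriv v t x +
    (\<Sum>j\<in>UNIV. (e $ j) *\<^sub>R space_deriv j (v t) x))"
  have D1: "D (1, 0) = (\<lambda>(t, x). time_deriv v t x)"
    and D2: "D (0, axis j 1) = (\<lambda>(t, x). space_deriv j (v t) x)" for j
    by (auto simp: D_def axis_def fun_eq_iff if_distrib[where f="\<lambda>r. r *\<^sub>R _"] cong: if_cong)
  have B: "(Basis :: (real \<times> (real ^ 'd)) set) = insert (1, 0) (range (\<lambda>j. (0, axis j 1)))"
    by (auto simp: Basis_prod_def Basis_vec_real)
  have "(?g has_derivative (\<lambda>h. \<Sum>b\<in>Basis. (h \<bullet> b) *\<^sub>R D b (t, x))) (at (t, x))"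
  proof (rule has_derivative_if_continuous_partials)
    show "open (I \<times> (UNIV :: (real ^ 'd) set))" using assms by (simp add: open_Times)
    show "(t, x) \<in> I \<times> UNIV" using assms by simp
    show "continuous_on (I \<times> UNIV) (D b)" if "b \<in> Basis" for b
      using that assms(1) by (auto simp: B D1 D2 C12_on_def)
    fix p :: "real \<times> (real ^ 'd)" and b :: "real \<times> (real ^ 'd)"
    assume "p \<in> I \<times> UNIV" and b: "b \<in> Basis"
    then obtain t x where p: "p = (t, x)" "t \<in> I" by auto
    show "((\<lambda>s. ?g (p + s *\<^sub>R b)) has_vector_derivative D b p) (at 0)"
    proof (cases "b = (1, 0)")
      case True
      have "((\<lambda>s. v s x) has_vector_derivative time_deriv v t x) (at (0 + t))"
        using assms(1) p by (simp add: C12_on_def time_deriv_def vector_derivative_works)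
      then have "((\<lambda>s. v (s + t) x) has_vector_derivative 1 *\<^sub>R time_deriv v t x) (at 0)"
        by (intro vector_diff_chain_at[where f="\<lambda>s. s + t", unfolded o_def])
           (auto intro!: derivative_eq_intros)
      then show ?thesis unfolding True D1 by (simp add: p add.commute)
    next
      case False
      then obtain j where j: "b = (0, axis j 1)" using b by (auto simp: B)
      show ?thesis unfolding j D2 using assms(1) p
        by (auto simp: C12_on_def intro!: has_space_deriv)
    qed
  qed
  moreover have "(\<Sum>b\<in>Basis. (h \<bullet> b) *\<^sub>R D b (t, x)) = fst h *\<^sub>R time_deriv v t x +
      (\<Sum>j\<in>UNIV. (snd h $ j) *\<^sub>R space_deriv j (v t) x)" for h
  proof -
    have "inj (\<lambda>j::'d. (0::real, axis j (1::real)))" by (auto simp: inj_on_def axis_eq_axis)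
    then show ?thesis unfolding B
      by (subst sum.insert) (auto simp: sum.reindex D1 D2 inner_prod_def inner_axis)
  qed
  ultimately show ?thesis by (simp add: case_prod_beta')
qed

section \<open>Derivatives of a dilated function times a quadratic phase\<close>

definition quadratic_phase :: "real \<Rightarrow> real ^ 'd \<Rightarrow> complex" where
  "quadratic_phase b x = exp (\<i> * complex_of_real (b * ((norm x)\<^sup>2 / 2)))"

text \<open>Left general in \<open>f\<close> so that it applies both to \<open>v\<close> at a fixed
  time and to a space derivative of \<open>v\<close>; the second derivatives then come from the same
  formula.\<close>

lemma has_space_deriv_quadratic_phase:
  fixes f :: "real ^ 'd \<Rightarrow> complex"
  assumes "space_differentiable j f (x /\<^sub>R n)"
  shows "((\<lambda>s. f ((x + s *\<^sub>R axis j 1) /\<^sub>R n) * quadratic_phase b (x + s *\<^sub>R axis j 1))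
    has_vector_derivative
      (space_deriv j f (x /\<^sub>R n) / n + \<i> * b * (x $ j) * f (x /\<^sub>R n)) * quadratic_phase b x) (at 0)"
proof -
  have "((\<lambda>s. f (x /\<^sub>R n + s *\<^sub>R axis j 1)) has_vector_derivative space_deriv j f (x /\<^sub>R n)) (at (0 / n))"
    using has_space_deriv[OF assms] by simp
  then have "((\<lambda>s. f (x /\<^sub>R n + (s / n) *\<^sub>R axis j 1)) has_vector_derivative
      (1 / n) *\<^sub>R space_deriv j f (x /\<^sub>R n)) (at 0)"
    by (intro vector_diff_chain_at[where f="\<lambda>s. s / n", unfolded o_def])
       (auto intro!: derivative_eq_intros
          simp: divide_inverse simp flip: has_real_derivative_iff_has_vector_derivative)
  then have 1: "((\<lambda>s. f ((x + s *\<^sub>R axis j 1) /\<^sub>R n)) has_vector_derivative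
      space_deriv j f (x /\<^sub>R n) / n) (at 0)"
    by (simp add: algebra_simps divide_inverse scaleR_conv_of_real)
  \<comment> \<open>Expanding the square replaces the norm, which is not differentiable at the
    origin, by a polynomial in \<open>s\<close>.\<close>
  have sq: "(norm (x + s *\<^sub>R axis j 1))\<^sup>2 = (norm x)\<^sup>2 + 2 * s * (x $ j) + s\<^sup>2" for s
    unfolding power2_norm_eq_inner
    by (simp add: inner_add_left inner_add_right inner_axis inner_axis' power2_eq_square distrib_left)
  have "((\<lambda>s. b * (((norm x)\<^sup>2 + 2 * s * (x $ j) + s\<^sup>2) / 2)) has_real_derivative b * (x $ j)) (at 0)"
    by (auto intro!: derivative_eq_intros)
  then have "((\<lambda>s. complex_of_real (b * (((norm x)\<^sup>2 + 2 * s * (x $ j) + s\<^sup>2) / 2)))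
      has_vector_derivative complex_of_real (b * (x $ j))) (at 0)"
    by (rule has_vector_derivative_of_real)
  then have "((\<lambda>s. \<i> * complex_of_real (b * (((norm x)\<^sup>2 + 2 * s * (x $ j) + s\<^sup>2) / 2)))
      has_vector_derivative \<i> * complex_of_real (b * (x $ j))) (at 0)"
    by (rule has_vector_derivative_mult_right)
  from field_vector_diff_chain_at[OF this DERIV_exp]
  have 2: "((\<lambda>s. quadratic_phase b (x + s *\<^sub>R axis j 1)) has_vector_derivative
      \<i> * b * (x $ j) * quadratic_phase b x) (at 0)"
    by (simp add: quadratic_phase_def o_def sq mult.assoc)
  show ?thesis
    using has_vector_derivative_mult[OF 1 2] by (simp add: algebra_simps)
qed

section \<open>The lens transform with abstract coefficients\<close>

text \<open>The intended instance is \<open>A = \<nu> powr (- d/2)\<close>, \<open>n = \<nu>\<close>, \<open>b = \<nu>'/\<nu>\<close>, \<open>\<tau> = \<mu>/\<nu>\<close> and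
  \<open>\<beta> = \<nu>''/\<nu> = - \<Omega>\<close>.\<close>

locale lens_transform =
  fixes v w :: "real \<Rightarrow> real ^ 'd \<Rightarrow> complex" and I J :: "real set" and A b n \<tau> \<beta> :: "real \<Rightarrow> real"
  assumes v: "C12_on I v" and open_I: "open I" and open_J: "open J"
    and \<tau>_in: "\<And>t. t \<in> J \<Longrightarrow> \<tau> t \<in> I"
    and n_pos: "\<And>t. t \<in> J \<Longrightarrow> n t > 0"
    and A': "\<And>t. t \<in> J \<Longrightarrow> (A has_real_derivative - (real CARD('d) / 2 * b t * A t)) (at t)"
    and n': "\<And>t. t \<in> J \<Longrightarrow> (n has_real_derivative b t * n t) (at t)"
    and b': "\<And>t. t \<in> J \<Longrightarrow> (b has_real_derivative \<beta> t - (b t)\<^sup>2) (at t)"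
    and \<tau>': "\<And>t. t \<in> J \<Longrightarrow> (\<tau> has_real_derivative 1 / (n t)\<^sup>2) (at t)"
    and cont_\<beta>: "continuous_on J \<beta>"
    and w: "\<And>t. t \<in> J \<Longrightarrow> w t = (\<lambda>x. A t * v (\<tau> t) (x /\<^sub>R n t) * quadratic_phase (b t) x)"
begin

lemma n_nonzero: "t \<in> J \<Longrightarrow> n t \<noteq> 0"
  using n_pos[of t] by simp

lemma has_space_deriv_w:
  assumes "t \<in> J"
  shows "((\<lambda>s. w t (x + s *\<^sub>R axis j 1)) has_vector_derivative
    A t * (space_deriv j (v (\<tau> t)) (x /\<^sub>R n t) / n t + \<i> * b t * (x $ j) * v (\<tau> t) (x /\<^sub>R n t))
      * quadratic_phase (b t) x) (at 0)"
proof -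
  have "space_differentiable j (v (\<tau> t)) (x /\<^sub>R n t)"
    using v \<tau>_in[OF assms] by (simp add: C12_on_def)
  from has_vector_derivative_mult_right[OF has_space_deriv_quadratic_phase[OF this], of "A t"]
  show ?thesis by (simp add: w[OF assms] mult.assoc)
qed

lemma space_deriv_w:
  assumes "t \<in> J"
  shows "space_deriv j (w t) = (\<lambda>x.
    A t * (space_deriv j (v (\<tau> t)) (x /\<^sub>R n t) / n t + \<i> * b t * (x $ j) * v (\<tau> t) (x /\<^sub>R n t))
      * quadratic_phase (b t) x)"
  using space_deriv_eqI[OF has_space_deriv_w[OF assms]] by (intro ext) blast

text \<open>Mixed derivatives are included because \<open>C12_on\<close> asks for them; the diagonal
  yields the Laplacian. The term with \<open>j = k\<close> comes from differentiating the factor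
  \<open>x $ j\<close> that the phase produced in the first derivative.\<close>

definition second_deriv_w :: "'d \<Rightarrow> 'd \<Rightarrow> real \<Rightarrow> real ^ 'd \<Rightarrow> complex" where
  "second_deriv_w j k t x =
    A t * (space_deriv k (space_deriv j (v (\<tau> t))) (x /\<^sub>R n t) / (n t)\<^sup>2
      + \<i> * b t * ((x $ k) * space_deriv j (v (\<tau> t)) (x /\<^sub>R n t)
          + (x $ j) * space_deriv k (v (\<tau> t)) (x /\<^sub>R n t)) / n t
      + (if j = k then \<i> * b t else 0) * v (\<tau> t) (x /\<^sub>R n t)
      - (b t)\<^sup>2 * (x $ j) * (x $ k) * v (\<tau> t) (x /\<^sub>R n t)) * quadratic_phase (b t) x"

lemma has_space_deriv_space_deriv_w:
  assumes "t \<in> J"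
  shows "((\<lambda>s. space_deriv j (w t) (x + s *\<^sub>R axis k 1)) has_vector_derivative
    second_deriv_w j k t x) (at 0)"
proof -
  have sd: "space_differentiable k (v (\<tau> t)) (x /\<^sub>R n t)"
    "space_differentiable k (space_deriv j (v (\<tau> t))) (x /\<^sub>R n t)"
    using v \<tau>_in[OF assms] by (simp_all add: C12_on_def)
  have "((\<lambda>s. (x + s *\<^sub>R axis k 1) $ j) has_real_derivative (if j = k then 1 else 0)) (at 0)"
    by (auto simp: axis_def intro!: derivative_eq_intros)
  then have "((\<lambda>s. complex_of_real ((x + s *\<^sub>R axis k 1) $ j)) has_vector_derivative
      complex_of_real (if j = k then 1 else 0)) (at 0)"
    by (rule has_vector_derivative_of_real)
  \<comment> \<open>Both summands of the first derivative are built from a dilated function times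
    the phase: \<open>1 / n\<close> times the one for \<open>space_deriv j\<close> of
    \<open>v\<close>, and \<open>\<i> * b * x $ j\<close> times the one for
    \<open>v\<close>.\<close>
  from has_vector_derivative_mult_right[OF has_vector_derivative_add[OF
      has_vector_derivative_mult_right[OF has_space_deriv_quadratic_phase[OF sd(2), of "b t"],
        of "1 / n t"]
      has_vector_derivative_mult_right[OF has_vector_derivative_mult[OF this
        has_space_deriv_quadratic_phase[OF sd(1), of "b t"]], of "\<i> * b t"]], of "A t"]
  show ?thesis
    unfolding space_deriv_w[OF assms]
    \<comment> \<open>The product rule leaves the phase inside each summand; function and derivative
      are both regrouped to factor it out.\<close>
    by (rule has_vector_derivative_eq_rhs[OF has_vector_derivative_transform_within_open[OF _ open_UNIV UNIV_I]])
       (use n_nonzero[OF assms] in \<open>auto simp: second_deriv_w_def field_simps power2_eq_square\<close>)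
qed

lemma space_deriv_space_deriv_w:
  "t \<in> J \<Longrightarrow> space_deriv k (space_deriv j (w t)) x = second_deriv_w j k t x"
  by (rule space_deriv_eqI) (rule has_space_deriv_space_deriv_w)

text \<open>The first two terms come from the motion of the arguments of \<open>v\<close>, the third
  from the amplitude \<open>A\<close>, the last from the phase.\<close>

definition time_deriv_w :: "real \<Rightarrow> real ^ 'd \<Rightarrow> complex" where
  "time_deriv_w t x =
    A t * (time_deriv v (\<tau> t) (x /\<^sub>R n t) / (n t)\<^sup>2
      - b t / n t * (\<Sum>j\<in>UNIV. (x $ j) * space_deriv j (v (\<tau> t)) (x /\<^sub>R n t))
      - real CARD('d) / 2 * b t * v (\<tau> t) (x /\<^sub>R n t)
      + \<i> * (\<beta> t - (b t)\<^sup>2) * ((norm x)\<^sup>2 / 2) * v (\<tau> t) (x /\<^sub>R n t)) * quadratic_phase (b t) x"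

lemma has_time_deriv_w:
  assumes "t \<in> J"
  shows "((\<lambda>s. w s x) has_vector_derivative time_deriv_w t x) (at t)"
proof -
  note n0 = n_nonzero[OF assms]
  have "((\<lambda>s. inverse (n s)) has_real_derivative - (b t / n t)) (at t)"
    using n'[OF assms] n0 by (auto intro!: derivative_eq_intros simp: divide_inverse)
  from has_vector_derivative_scaleR[OF this has_vector_derivative_const[of x]]
  have "((\<lambda>s. x /\<^sub>R n s) has_vector_derivative (- (b t / n t)) *\<^sub>R x) (at t)"
    by simp
  with \<tau>'[OF assms] have "((\<lambda>s. (\<tau> s, x /\<^sub>R n s)) has_vector_derivative
      (1 / (n t)\<^sup>2, (- (b t / n t)) *\<^sub>R x)) (at t)"
    by (intro has_vector_derivative_Pair) (simp add: has_real_derivative_iff_has_vector_derivative)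
  then have "((\<lambda>s. (\<tau> s, x /\<^sub>R n s)) has_derivative
      (\<lambda>r. r *\<^sub>R (1 / (n t)\<^sup>2, (- (b t / n t)) *\<^sub>R x))) (at t)"
    by (simp add: has_vector_derivative_def)
  \<comment> \<open>The Frechet derivative of \<open>v\<close> is applied to the velocity of the
    curve, whose time component is \<open>1 / n\<^sup>2\<close> and whose space component is
    \<open>- (b / n) x\<close>.\<close>
  from has_derivative_compose[OF this C12_on_has_derivative[OF v open_I \<tau>_in[OF assms]],
      unfolded scaleR_Pair prod.case]
  have 1: "((\<lambda>s. v (\<tau> s) (x /\<^sub>R n s)) has_vector_derivative
      time_deriv v (\<tau> t) (x /\<^sub>R n t) / (n t)\<^sup>2
      - b t / n t * (\<Sum>j\<in>UNIV. (x $ j) * space_deriv j (v (\<tau> t)) (x /\<^sub>R n t))) (at t)"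
    unfolding has_vector_derivative_def
    by (rule has_derivative_eq_rhs)
       (auto simp: fun_eq_iff scaleR_conv_of_real[where 'a=complex] sum_distrib_left algebra_simps sum_negf)
  have "((\<lambda>s. b s * ((norm x)\<^sup>2 / 2)) has_real_derivative (\<beta> t - (b t)\<^sup>2) * ((norm x)\<^sup>2 / 2)) (at t)"
    using b'[OF assms] by (rule DERIV_cmult_right)
  then have "((\<lambda>s. \<i> * complex_of_real (b s * ((norm x)\<^sup>2 / 2))) has_vector_derivative
      \<i> * complex_of_real ((\<beta> t - (b t)\<^sup>2) * ((norm x)\<^sup>2 / 2))) (at t)"
    by (intro has_vector_derivative_mult_right has_vector_derivative_of_real)
  from field_vector_diff_chain_at[OF this DERIV_exp]
  have 2: "((\<lambda>s. quadratic_phase (b s) x) has_vector_derivative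
      \<i> * ((\<beta> t - (b t)\<^sup>2) * ((norm x)\<^sup>2 / 2)) * quadratic_phase (b t) x) (at t)"
    by (simp add: quadratic_phase_def o_def)
  from has_vector_derivative_mult[OF has_vector_derivative_mult[OF
      has_vector_derivative_of_real[OF A'[OF assms]] 1] 2]
  show ?thesis
    \<comment> \<open>The formula for \<open>w\<close> is known only for times in \<open>J\<close>;
      since \<open>J\<close> is open, this determines the derivative at \<open>t\<close>.\<close>
    by (rule has_vector_derivative_eq_rhs[OF has_vector_derivative_transform_within_open[OF _ open_J assms]])
       (auto simp: w time_deriv_w_def algebra_simps add_divide_distrib diff_divide_distrib)
qed

lemma time_deriv_w: "t \<in> J \<Longrightarrow> time_deriv w t x = time_deriv_w t x"
  unfolding time_deriv_def by (rule vector_derivative_at) (rule has_time_deriv_w)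

section \<open>Regularity of the transformed function\<close>

text \<open>Carries the joint continuity of \<open>v\<close> and of each of its partial derivatives
  through the change of variables.\<close>

lemma continuous_on_comp_lens:
  fixes f :: "real \<Rightarrow> real ^ 'd \<Rightarrow> complex"
  assumes "continuous_on (I \<times> UNIV) (\<lambda>(t, x). f t x)"
  shows "continuous_on (J \<times> UNIV) (\<lambda>p. f (\<tau> (fst p)) (snd p /\<^sub>R n (fst p)))"
proof -
  have "continuous_on (J \<times> (UNIV :: (real ^ 'd) set)) (\<lambda>p. \<tau> (fst p))"
       "continuous_on (J \<times> (UNIV :: (real ^ 'd) set)) (\<lambda>p. n (fst p))"
    by (rule continuous_on_compose2[OF _ continuous_on_fst[OF continuous_on_id]];
        auto intro!: continuous_at_imp_continuous_on DERIV_isCont \<tau>' n')+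
  then have "continuous_on (J \<times> (UNIV :: (real ^ 'd) set)) (\<lambda>p. (\<tau> (fst p), snd p /\<^sub>R n (fst p)))"
    by (intro continuous_intros) (auto simp: n_nonzero)
  moreover have "(\<lambda>p. (\<tau> (fst p), snd p /\<^sub>R n (fst p))) ` (J \<times> (UNIV :: (real ^ 'd) set)) \<subseteq> I \<times> UNIV"
    using \<tau>_in by auto
  ultimately show ?thesis
    using continuous_on_compose2[OF assms] by fastforce
qed

lemma C12_on_w: "C12_on J w"
proof -
  let ?S = "J \<times> (UNIV :: (real ^ 'd) set)"
  have coeff: "continuous_on ?S (\<lambda>p. A (fst p))" "continuous_on ?S (\<lambda>p. n (fst p))"
    "continuous_on ?S (\<lambda>p. b (fst p))" "continuous_on ?S (\<lambda>p. \<beta> (fst p))"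
    by (rule continuous_on_compose2[OF _ continuous_on_fst[OF continuous_on_id]];
        auto intro!: cont_\<beta> continuous_at_imp_continuous_on DERIV_isCont A' n' b')+
  have phase: "continuous_on ?S (\<lambda>p. quadratic_phase (b (fst p)) (snd p))"
    unfolding quadratic_phase_def by (intro continuous_intros coeff) auto
  have vs:
    "continuous_on ?S (\<lambda>p. v (\<tau> (fst p)) (snd p /\<^sub>R n (fst p)))"
    "continuous_on ?S (\<lambda>p. time_deriv v (\<tau> (fst p)) (snd p /\<^sub>R n (fst p)))"
    "continuous_on ?S (\<lambda>p. space_deriv j (v (\<tau> (fst p))) (snd p /\<^sub>R n (fst p)))"
    "continuous_on ?S (\<lambda>p. space_deriv k (space_deriv j (v (\<tau> (fst p)))) (snd p /\<^sub>R n (fst p)))" for j k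
    using v by (auto simp: C12_on_def intro!: continuous_on_comp_lens)
  have n0: "\<forall>p\<in>?S. complex_of_real (n (fst p)) \<noteq> 0" "\<forall>p\<in>?S. complex_of_real ((n (fst p))\<^sup>2) \<noteq> 0"
    by (auto simp: n_nonzero)
  note intros = continuous_intros coeff phase vs n0
  have "continuous_on ?S (\<lambda>p. w (fst p) (snd p))"
    by (rule continuous_on_eq[where f="\<lambda>p. A (fst p) * v (\<tau> (fst p)) (snd p /\<^sub>R n (fst p)) *
          quadratic_phase (b (fst p)) (snd p)"])
       (intro intros, auto simp: w)
  moreover have "continuous_on ?S (\<lambda>p. time_deriv w (fst p) (snd p))"
    by (rule continuous_on_eq[where f="\<lambda>p. time_deriv_w (fst p) (snd p)"],
        unfold time_deriv_w_def, intro intros) (auto simp: time_deriv_w time_deriv_w_def n_nonzero)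
  moreover have "continuous_on ?S (\<lambda>p. space_deriv j (w (fst p)) (snd p))" for j
    by (rule continuous_on_eq[where f="\<lambda>p. A (fst p) *
          (space_deriv j (v (\<tau> (fst p))) (snd p /\<^sub>R n (fst p)) / n (fst p)
            + \<i> * b (fst p) * (snd p $ j) * v (\<tau> (fst p)) (snd p /\<^sub>R n (fst p)))
          * quadratic_phase (b (fst p)) (snd p)"])
       (intro intros, auto simp: space_deriv_w)
  moreover have "continuous_on ?S (\<lambda>p. space_deriv k (space_deriv j (w (fst p))) (snd p))" for j k
  proof (rule continuous_on_eq[where f="\<lambda>p. second_deriv_w j k (fst p) (snd p)"])
    \<comment> \<open>The condition does not depend on the point, so the continuity of this
      coefficient is settled by cases before the general rules are applied.\<close>
    have "continuous_on ?S (\<lambda>p. if j = k then \<i> * complex_of_real (b (fst p)) else 0)"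
      by (cases "j = k") (auto intro!: intros)
    then show "continuous_on ?S (\<lambda>p. second_deriv_w j k (fst p) (snd p))"
      unfolding second_deriv_w_def by (intro intros)
  qed (auto simp: space_deriv_space_deriv_w)
  ultimately show ?thesis
    using has_time_deriv_w has_space_deriv_w has_space_deriv_space_deriv_w
    by (auto simp: C12_on_def case_prod_beta' intro!: space_differentiableI differentiableI_vector)
qed

text \<open>An identity for every \<open>v\<close> of the class, solution or not: the equation for
  \<open>v\<close> will enter only through \<open>V\<close>. Half the Laplacian gives
  \<open>- b\<^sup>2 |x|\<^sup>2 / 2\<close>, the time derivative of the phase gives
  \<open>- (\<beta> - b\<^sup>2) |x|\<^sup>2 / 2\<close>, and only \<open>\<beta>\<close>
  survives.\<close>

lemma schroedinger_operator_w:
  fixes V :: complex and x :: "real ^ 'd"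
  assumes "t \<in> J"
  defines "V \<equiv> \<i> * time_deriv v (\<tau> t) (x /\<^sub>R n t) + 1 / 2 * laplacian (v (\<tau> t)) (x /\<^sub>R n t)"
  shows "\<i> * time_deriv w t x + 1 / 2 * laplacian (w t) x =
    A t * V / (n t)\<^sup>2 * quadratic_phase (b t) x - \<beta> t * (norm x)\<^sup>2 / 2 * w t x"
proof -
  define y where "y = x /\<^sub>R n t"
  define E where "E = quadratic_phase (b t) x"
  define f where "f = v (\<tau> t) y"
  define P where "P = (\<Sum>j\<in>UNIV. (x $ j) * space_deriv j (v (\<tau> t)) y)"
  have "(norm x)\<^sup>2 = (\<Sum>j\<in>UNIV. x $ j * x $ j)"
    by (simp add: power2_norm_eq_inner inner_vec_def)
  \<comment> \<open>The terms in \<open>b\<^sup>2\<close> arise one coordinate at a time; this form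
    lets the sum reassemble them into the squared norm.\<close>
  then have nx: "complex_of_real ((norm x)\<^sup>2) = (\<Sum>j\<in>UNIV. complex_of_real (x $ j) * x $ j)"
    by simp
  note n0 = n_nonzero[OF assms(1)]
  have "laplacian (w t) x = (\<Sum>j\<in>UNIV. A t * E / (n t)\<^sup>2 * space_deriv j (space_deriv j (v (\<tau> t))) y
      + A t * E * (2 * \<i> * b t / n t) * ((x $ j) * space_deriv j (v (\<tau> t)) y)
      + A t * E * \<i> * b t * f - A t * E * (b t)\<^sup>2 * f * (complex_of_real (x $ j) * x $ j))"
    unfolding laplacian_def space_deriv_space_deriv_w[OF assms(1)] second_deriv_w_def
    by (intro sum.cong) (auto simp: y_def E_def f_def algebra_simps add_divide_distrib)
  also have "\<dots> = A t * E / (n t)\<^sup>2 * laplacian (v (\<tau> t)) y + A t * E * (2 * \<i> * b t / n t) * P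
      + real CARD('d) * (A t * E * \<i> * b t * f) - A t * E * (b t)\<^sup>2 * f * (norm x)\<^sup>2"
    unfolding nx by (simp add: sum.distrib sum_subtractf sum_distrib_left laplacian_def P_def)
  finally have L: "laplacian (w t) x = \<dots>" .
  have T: "time_deriv w t x = A t * (time_deriv v (\<tau> t) y / (n t)\<^sup>2 - b t / n t * P
      - real CARD('d) / 2 * b t * f + \<i> * (\<beta> t - (b t)\<^sup>2) * ((norm x)\<^sup>2 / 2) * f) * E"
    unfolding time_deriv_w[OF assms(1)] time_deriv_w_def P_def y_def f_def E_def ..
  have W: "w t x = A t * f * E" by (simp add: w[OF assms(1)] f_def E_def y_def)
  show ?thesis
    unfolding V_def L T W y_def[symmetric] E_def[symmetric]
    using n0 by (simp add: field_simps power2_eq_square)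
qed

end


section \<open>The oscillator equation and the Wronskian\<close>

text \<open>In the derivative the products of first derivatives cancel, and so do the two terms with
  \<Omega>, since both functions satisfy the same equation.\<close>

lemma wronskian_constant:
  fixes \<mu> \<nu> \<mu>' \<nu>' \<Omega> :: "real \<Rightarrow> real"
  assumes "\<And>t. (\<mu> has_real_derivative \<mu>' t) (at t)" "\<And>t. (\<mu>' has_real_derivative - \<Omega> t * \<mu> t) (at t)"
    and "\<And>t. (\<nu> has_real_derivative \<nu>' t) (at t)" "\<And>t. (\<nu>' has_real_derivative - \<Omega> t * \<nu> t) (at t)"
  shows "\<mu>' t * \<nu> t - \<mu> t * \<nu>' t = \<mu>' 0 * \<nu> 0 - \<mu> 0 * \<nu>' 0"
  by (rule DERIV_isconst_all[of "\<lambda>t. \<mu>' t * \<nu> t - \<mu> t * \<nu>' t"])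
     (auto intro!: derivative_eq_intros assms simp: algebra_simps)

lemma oscillator_solutionD:
  assumes "oscillator_solution \<Omega> a b y"
  shows "(y has_real_derivative deriv y t) (at t)"
    "(deriv y has_real_derivative - \<Omega> t * y t) (at t)" "y 0 = a" "deriv y 0 = b"
proof -
  have "(deriv y has_real_derivative deriv (deriv y) t) (at t)"
    using assms by (simp add: oscillator_solution_def DERIV_deriv_iff_real_differentiable)
  moreover have "deriv (deriv y) t = - \<Omega> t * y t"
    using assms by (simp add: oscillator_solution_def eq_neg_iff_add_eq_0)
  ultimately show "(deriv y has_real_derivative - \<Omega> t * y t) (at t)" by simp
qed (use assms in \<open>auto simp: oscillator_solution_def DERIV_deriv_iff_real_differentiable\<close>)

theorem proposition4p1:
  fixes \<sigma> :: real and \<Omega> H \<mu> \<nu> :: "real \<Rightarrow> real" and I :: "real set"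
    and v :: "real \<Rightarrow> real ^ 'd \<Rightarrow> complex" and u0 :: "real ^ 'd \<Rightarrow> complex"
  assumes "\<sigma> > 0"
    and "continuous_on UNIV \<Omega>"
    and "open I" and "is_interval I" and "0 \<in> I"
    and "schroedinger_solution I
           (\<lambda>t x z. complex_of_real (H t) * complex_of_real (norm z powr (2 * \<sigma>)) * z) u0 v"
    and "oscillator_solution \<Omega> 0 1 \<mu>"
    and "oscillator_solution \<Omega> 1 0 \<nu>"
  shows "\<exists>T>0. (\<forall>t. \<bar>t\<bar> \<le> T \<longrightarrow> \<nu> t > 0 \<and> \<mu> t / \<nu> t \<in> I) \<and>
    (\<forall>u :: real \<Rightarrow> real ^ 'd \<Rightarrow> complex. \<forall>h :: real \<Rightarrow> real.
       (\<forall>t x. \<bar>t\<bar> \<le> T \<longrightarrow>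
          u t x = complex_of_real (1 / \<nu> t powr (real CARD('d) / 2))
                  * v (\<mu> t / \<nu> t) (x /\<^sub>R \<nu> t)
                  * exp (\<i> * complex_of_real (deriv \<nu> t / \<nu> t * ((norm x)\<^sup>2 / 2)))) \<longrightarrow>
       (\<forall>t. \<bar>t\<bar> \<le> T \<longrightarrow> h t = \<nu> t powr (real CARD('d) * \<sigma> - 2) * H (\<mu> t / \<nu> t)) \<longrightarrow>
       schroedinger_solution {-T<..<T}
         (\<lambda>t x z. complex_of_real (\<Omega> t * (norm x)\<^sup>2 / 2) * z
                 + complex_of_real (h t) * complex_of_real (norm z powr (2 * \<sigma>)) * z) u0 u)"
proof -
  note \<mu> = oscillator_solutionD[OF assms(7)] and \<nu> = oscillator_solutionD[OF assms(8)]
  have v: "C12_on I v" and v0: "v 0 x = u0 x" for x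
    using assms(6) by (auto simp: schroedinger_solution_def)
  have wronskian: "deriv \<mu> t * \<nu> t - \<mu> t * deriv \<nu> t = 1" for t
    using wronskian_constant[OF \<mu>(1,2) \<nu>(1,2), of t] \<mu>(3,4) \<nu>(3,4) by simp
  \<comment> \<open>At time 0 the value of \<nu> is 1 and the quotient is 0, which lies in
    \<open>I\<close>. Positivity and membership in \<open>I\<close> are open conditions, so they
    persist nearby.\<close>
  have "isCont \<mu> 0" "isCont \<nu> 0" using \<mu>(1) \<nu>(1) by (auto intro: DERIV_isCont)
  then have "isCont (\<lambda>t. \<mu> t / \<nu> t) 0" "isCont \<nu> 0"
    using \<nu>(3) by (auto intro!: continuous_intros)
  then have "((\<lambda>t. \<mu> t / \<nu> t) \<longlongrightarrow> \<mu> 0 / \<nu> 0) (nhds 0)" "(\<nu> \<longlongrightarrow> \<nu> 0) (nhds 0)"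
    using tendsto_at_iff_tendsto_nhds[of "\<lambda>t. \<mu> t / \<nu> t" 0] tendsto_at_iff_tendsto_nhds[of \<nu> 0]
    by (simp_all add: isCont_def)
  then have "eventually (\<lambda>t. \<mu> t / \<nu> t \<in> I) (nhds 0)" "eventually (\<lambda>t. \<nu> t \<in> {0<..}) (nhds 0)"
    using \<mu>(3) \<nu>(3) assms(3,5) by (auto elim!: topological_tendstoD simp del: greaterThan_iff)
  then have "eventually (\<lambda>t. \<nu> t > 0 \<and> \<mu> t / \<nu> t \<in> I) (nhds 0)"
    by eventually_elim auto
  then obtain e where "e > 0" and e: "\<And>t. dist t 0 < e \<Longrightarrow> \<nu> t > 0 \<and> \<mu> t / \<nu> t \<in> I"
    unfolding eventually_nhds_metric by blast
  \<comment> \<open>Halving \<open>e\<close> fits the closed interval into the open ball.\<close>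
  define T where "T = e / 2"
  have "T > 0" using \<open>e > 0\<close> by (simp add: T_def)
  have T: "\<nu> t > 0 \<and> \<mu> t / \<nu> t \<in> I" if "\<bar>t\<bar> \<le> T" for t
    using e[of t] that \<open>e > 0\<close> by (auto simp: T_def dist_norm)
  have "schroedinger_solution {-T<..<T}
         (\<lambda>t x z. complex_of_real (\<Omega> t * (norm x)\<^sup>2 / 2) * z
                 + complex_of_real (h t) * complex_of_real (norm z powr (2 * \<sigma>)) * z) u0 u"
    if u: "\<forall>t x. \<bar>t\<bar> \<le> T \<longrightarrow>
          u t x = complex_of_real (1 / \<nu> t powr (real CARD('d) / 2))
                  * v (\<mu> t / \<nu> t) (x /\<^sub>R \<nu> t)
                  * exp (\<i> * complex_of_real (deriv \<nu> t / \<nu> t * ((norm x)\<^sup>2 / 2)))"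
      and h: "\<forall>t. \<bar>t\<bar> \<le> T \<longrightarrow> h t = \<nu> t powr (real CARD('d) * \<sigma> - 2) * H (\<mu> t / \<nu> t)"
    for u :: "real \<Rightarrow> real ^ 'd \<Rightarrow> complex" and h :: "real \<Rightarrow> real"
  proof -
    let ?J = "{-T<..<T}" and ?A = "\<lambda>t. 1 / \<nu> t powr (real CARD('d) / 2)"
    have J: "\<bar>t\<bar> \<le> T" "\<nu> t > 0" "\<mu> t / \<nu> t \<in> I" if "t \<in> ?J" for t
      using T[of t] that by auto
    interpret lens_transform v u I ?J ?A "\<lambda>t. deriv \<nu> t / \<nu> t" \<nu> "\<lambda>t. \<mu> t / \<nu> t" "\<lambda>t. - \<Omega> t"
    proof
      fix t assume t: "t \<in> ?J"
      note pos = J(2)[OF t]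
      have "((\<lambda>t. \<nu> t powr - (real CARD('d) / 2)) has_real_derivative
          - (real CARD('d) / 2) * \<nu> t powr (- (real CARD('d) / 2) - 1) * deriv \<nu> t) (at t)"
        using pos by (auto intro!: derivative_eq_intros \<nu>(1) simp: powr_diff)
      moreover have "\<nu> t powr (- (real CARD('d) / 2) - 1) = ?A t / \<nu> t"
        using pos by (simp only: powr_diff powr_minus_divide powr_one)
      ultimately show "(?A has_real_derivative
          - (real CARD('d) / 2 * (deriv \<nu> t / \<nu> t) * ?A t)) (at t)"
        using pos by (simp add: powr_minus_divide mult_ac)
      show "(\<nu> has_real_derivative deriv \<nu> t / \<nu> t * \<nu> t) (at t)"
        using \<nu>(1)[of t] pos by simp
      show "((\<lambda>t. deriv \<nu> t / \<nu> t) has_real_derivative - \<Omega> t - (deriv \<nu> t / \<nu> t)\<^sup>2) (at t)"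
        using pos by (auto intro!: derivative_eq_intros \<nu>(1,2) simp: field_simps power2_eq_square)
      have "((\<lambda>t. \<mu> t / \<nu> t) has_real_derivative
          (deriv \<mu> t * \<nu> t - \<mu> t * deriv \<nu> t) / (\<nu> t * \<nu> t)) (at t)"
        using pos by (intro DERIV_divide \<mu>(1) \<nu>(1)) auto
      then show "((\<lambda>t. \<mu> t / \<nu> t) has_real_derivative 1 / (\<nu> t)\<^sup>2) (at t)"
        by (simp add: wronskian power2_eq_square)
      show "u t = (\<lambda>x. complex_of_real (?A t) * v (\<mu> t / \<nu> t) (x /\<^sub>R \<nu> t)
          * quadratic_phase (deriv \<nu> t / \<nu> t) x)"
        using u J(1)[OF t] by (auto simp: quadratic_phase_def)
    qed (use v J assms(2,3) in \<open>auto intro!: continuous_intros intro: continuous_on_subset\<close>)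
    have "\<i> * time_deriv u t x + (1 / 2) * laplacian (u t) x =
        complex_of_real (\<Omega> t * (norm x)\<^sup>2 / 2) * u t x
        + complex_of_real (h t) * complex_of_real (norm (u t x) powr (2 * \<sigma>)) * u t x"
      if t: "t \<in> ?J" for t x
    proof -
      note pos = J(2)[OF t]
      define y where "y = x /\<^sub>R \<nu> t"
      define f where "f = v (\<mu> t / \<nu> t) y"
      define E where "E = quadratic_phase (deriv \<nu> t / \<nu> t) x"
      have eq: "\<i> * time_deriv v (\<mu> t / \<nu> t) y + 1 / 2 * laplacian (v (\<mu> t / \<nu> t)) y =
          complex_of_real (H (\<mu> t / \<nu> t)) * complex_of_real (norm f powr (2 * \<sigma>)) * f"
        using assms(6) J(3)[OF t] unfolding schroedinger_solution_def f_def by blast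
      have utx: "u t x = ?A t * f * E" by (simp add: w[OF t] f_def y_def E_def)
      \<comment> \<open>The phase has modulus one, so the nonlinearity sees only the amplitude and
        the value of \<open>v\<close>.\<close>
      have "norm E = 1" by (simp add: E_def quadratic_phase_def)
      then have "norm (u t x) powr (2 * \<sigma>) = ?A t powr (2 * \<sigma>) * norm f powr (2 * \<sigma>)"
        unfolding utx using pos by (simp add: norm_mult norm_divide powr_mult powr_divide)
      \<comment> \<open>The amplitude contributes the power \<open>- d \<sigma>\<close> of \<nu>;
        with the power \<open>d \<sigma> - 2\<close> in \<open>h\<close> this leaves
        \<open>1 / \<nu>\<^sup>2\<close>, the factor that the dilation puts on the equation for
        \<open>v\<close>.\<close>
      also have "?A t powr (2 * \<sigma>) = 1 / \<nu> t powr (real CARD('d) * \<sigma>)"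
        using pos by (simp add: powr_divide powr_powr)
      finally have "h t * norm (u t x) powr (2 * \<sigma>) =
          H (\<mu> t / \<nu> t) * norm f powr (2 * \<sigma>) / (\<nu> t)\<^sup>2"
        using pos h J(1)[OF t] by (simp add: powr_diff)
      then have "complex_of_real (h t) * complex_of_real (norm (u t x) powr (2 * \<sigma>)) =
          complex_of_real (H (\<mu> t / \<nu> t) * norm f powr (2 * \<sigma>) / (\<nu> t)\<^sup>2)"
        by (simp flip: of_real_mult)
      then show ?thesis
        unfolding schroedinger_operator_w[OF t] y_def[symmetric] eq E_def[symmetric]
        by (simp add: utx mult_ac)
    qed
    \<comment> \<open>At time 0 the amplitude, the dilation and the phase are all trivial, because
      \<open>\<nu> 0 = 1\<close>, \<open>deriv \<nu> 0 = 0\<close> and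
      \<open>\<mu> 0 = 0\<close>.\<close>
    moreover have "u 0 x = u0 x" for x
      using u \<open>T > 0\<close> \<mu>(3) \<nu>(3,4) v0 by simp
    ultimately show ?thesis
      using C12_on_w unfolding schroedinger_solution_def by blast
  qed
  with \<open>T > 0\<close> T show ?thesis by blast
qed

end
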